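(* Let $n\geq 3$, and let $\mathcal{F}^1=\{F_r^1: 1\leq r\leq 2n-1\}$ and $\mathcal{F}^2=\{F_r^2: 1\leq r\leq 2n+1\}$ be as constructed in the context. Then $\mathcal{F}^1$ is a one-factorisation of $K_{2n}$ and $\mathcal{F}^2$ is a one-factorisation of $K_{2n+2}$. Moreover, the number of edges $\{x,y\}$ of $K_{2n}$ such that $\{x,y\}\in F_r^1\cap F_{r'}^2$ for some $r,r'$ with $r'\equiv r \pmod{2n-1}$ (i.e. the number of common fixtures when $F_r^1$ is the draw of division one in rounds $r$ and $r+2n-1$ and $F_{r'}^2$ is the draw of division two in round $r'$) equals $2n^2-3n+4$.
   Context: $K_{2n}$ is the complete graph on vertex set $V_1=\{0,1,\ldots,2n-3\}\cup\{-\infty,\infty\}$ and $K_{2n+2}$ the complete graph on $V_2=V_1\cup\{-i\infty,i\infty\}$, where $\pm\infty,\pm i\infty$ are four distinct symbols. A one-factor is a set of edges covering every vertex exactly once; a one-factorisation is a set of pairwise edge-disjoint one-factors whose union is all edges. Let $\sigma$ be the permutation of $V_2$ with $\sigma(x)=x+1 \bmod (2n-2)$ for $0\leq x\leq 2n-3$ and fixing $\pm\infty,\pm i\infty$; it acts on edges by $\sigma(\{x,y\})=\{\sigma(x),\sigma(y)\}$. Define $s=\frac{n-4}{2}$, $u=\frac{3n-6}{2}$ if $n$ is even and $s=\frac{n-3}{2}$, $u=\frac{3n-7}{2}$ if $n$ is odd; $t=n-2-s$, $v=3n-5-u$. Let $E_1=\{\{x,n-2-x\}: 0\leq x\leq s\}$,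 $E_2=\{\{x,3n-5-x\}: n-1\leq x\leq u\}$, $E_3=\{\{\frac{n-2}{2},-\infty\},\{2n-3,\infty\}\}$ ($n$ even) or $\{\{\frac{3n-5}{2},-\infty\},\{2n-3,\infty\}\}$ ($n$ odd), $E_4=\{\{u,-i\infty\},\{v,i\infty\}\}$ ($n$ even) or $\{\{s,-i\infty\},\{t,i\infty\}\}$ ($n$ odd). Let $e^*=\{u,v\}$ if $n$ is even and $e^*=\{s,t\}$ if $n$ is odd. Set $F_1^1=E_1\cup E_2\cup E_3$ and $F_1^2=(F_1^1\cup E_4)\setminus\{e^*\}$. For $1\leq r\leq 2n-2$ and $d=1,2$ put $F_r^d=\sigma^{r-1}(F_1^d)$. Put $F_{2n-1}^1=\{\{x,x+n-1\}:0\leq x\leq n-2\}\cup\{\{-\infty,\infty\}\}$ and $F_{2n-1}^2=F_{2n-1}^1\cup\{\{-i\infty,i\infty\}\}$. Let $T_1=\{\sigma^{2j}(e^* ): 0\leq j\leq n-2\}$, $T_2=\sigma(T_1)$, and $F_{2n}^2=T_1\cup\{\{-\infty,-i\infty\},\{\infty,i\infty\}\}$, $F_{2n+1}^2=T_2\cup\{\{-\infty,i\infty\},\{\infty,-i\infty\}\}$. *)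

theory Defs
  imports "HOL-Library.Ramsey" "HOL-Number_Theory.Cong"
begin

text \<open>
  A graph is given by its vertex set \<open>V\<close> and its edge set \<open>E\<close>, edges being two-element sets of
  vertices. The edge set of the complete graph on \<open>V\<close> is the library's \<open>nsets V 2\<close>, the set of all
  two-element subsets of \<open>V\<close>.
\<close>

definition one_factor :: "'a set \<Rightarrow> 'a set set \<Rightarrow> 'a set set \<Rightarrow> bool" where
  "one_factor V E F \<longleftrightarrow> F \<subseteq> E \<and> (\<forall>v\<in>V. \<exists>!e. e \<in> F \<and> v \<in> e)"

definition one_factorisation :: "'a set \<Rightarrow> 'a set set \<Rightarrow> 'a set set set \<Rightarrow> bool" where
  "one_factorisation V E \<F> \<longleftrightarrow>
     (\<forall>F\<in>\<F>. one_factor V E F) \<and> pairwise disjnt \<F> \<and> \<Union>\<F> = E"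

text \<open>
  The four symbols are rendered as \<open>MInf\<close> for $-\infty$, \<open>PInf\<close> for $\infty$, \<open>MIInf\<close> for
  $-i\infty$ and \<open>PIInf\<close> for $i\infty$.
\<close>

datatype vertex = Num nat | MInf | PInf | MIInf | PIInf

definition V1 :: "nat \<Rightarrow> vertex set" where
  "V1 n = Num ` {0..2 * n - 3} \<union> {MInf, PInf}"

definition V2 :: "nat \<Rightarrow> vertex set" where
  "V2 n = V1 n \<union> {MIInf, PIInf}"

text \<open>
  Only the values of \<open>\<sigma> n\<close> on \<open>V2 n\<close>, which it permutes, matter.
\<close>

fun \<sigma> :: "nat \<Rightarrow> vertex \<Rightarrow> vertex" where
  "\<sigma> n (Num x) = Num ((x + 1) mod (2 * n - 2))"
| "\<sigma> n MInf = MInf"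
| "\<sigma> n PInf = PInf"
| "\<sigma> n MIInf = MIInf"
| "\<sigma> n PIInf = PIInf"

definition rot :: "nat \<Rightarrow> nat \<Rightarrow> vertex set \<Rightarrow> vertex set" where
  "rot n k e = (\<sigma> n ^^ k) ` e"

text \<open>
  The suffix \<open>_idx\<close> keeps the one-letter names $s,t,u,v$ free for variables.
  For \<open>n \<ge> 3\<close> all divisions by two below are exact, and no subtraction of natural numbers
  is truncated within the stated index ranges.
\<close>

definition s_idx :: "nat \<Rightarrow> nat" where
  "s_idx n = (if even n then (n - 4) div 2 else (n - 3) div 2)"

definition u_idx :: "nat \<Rightarrow> nat" where
  "u_idx n = (if even n then (3 * n - 6) div 2 else (3 * n - 7) div 2)"

definition t_idx :: "nat \<Rightarrow> nat" where
  "t_idx n = n - 2 - s_idx n"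

definition v_idx :: "nat \<Rightarrow> nat" where
  "v_idx n = 3 * n - 5 - u_idx n"

definition E1 :: "nat \<Rightarrow> vertex set set" where
  "E1 n = (\<lambda>x. {Num x, Num (n - 2 - x)}) ` {0..s_idx n}"

definition E2 :: "nat \<Rightarrow> vertex set set" where
  "E2 n = (\<lambda>x. {Num x, Num (3 * n - 5 - x)}) ` {n - 1..u_idx n}"

definition E3 :: "nat \<Rightarrow> vertex set set" where
  "E3 n = (if even n
     then {{Num ((n - 2) div 2), MInf}, {Num (2 * n - 3), PInf}}
     else {{Num ((3 * n - 5) div 2), MInf}, {Num (2 * n - 3), PInf}})"

definition E4 :: "nat \<Rightarrow> vertex set set" where
  "E4 n = (if even n
     then {{Num (u_idx n), MIInf}, {Num (v_idx n), PIInf}}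
     else {{Num (s_idx n), MIInf}, {Num (t_idx n), PIInf}})"

definition e_star :: "nat \<Rightarrow> vertex set" where
  "e_star n = (if even n then {Num (u_idx n), Num (v_idx n)} else {Num (s_idx n), Num (t_idx n)})"

definition base1 :: "nat \<Rightarrow> vertex set set" where
  "base1 n = E1 n \<union> E2 n \<union> E3 n"

definition base2 :: "nat \<Rightarrow> vertex set set" where
  "base2 n = (base1 n \<union> E4 n) - {e_star n}"

definition diam1 :: "nat \<Rightarrow> vertex set set" where
  "diam1 n = (\<lambda>x. {Num x, Num (x + n - 1)}) ` {0..n - 2} \<union> {{MInf, PInf}}"

definition T1 :: "nat \<Rightarrow> vertex set set" where
  "T1 n = (\<lambda>j. rot n (2 * j) (e_star n)) ` {0..n - 2}"

definition T2 :: "nat \<Rightarrow> vertex set set" where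
  "T2 n = rot n 1 ` T1 n"

text \<open>
  \<open>F1 n r\<close> and \<open>F2 n r\<close> are $F_r^1$ and $F_r^2$, meaningful for \<open>1 \<le> r \<le> 2 * n - 1\<close> and
  \<open>1 \<le> r \<le> 2 * n + 1\<close> respectively.
\<close>

definition F1 :: "nat \<Rightarrow> nat \<Rightarrow> vertex set set" where
  "F1 n r = (if r = 2 * n - 1 then diam1 n else rot n (r - 1) ` base1 n)"

definition F2 :: "nat \<Rightarrow> nat \<Rightarrow> vertex set set" where
  "F2 n r =
    (if r = 2 * n - 1 then diam1 n \<union> {{MIInf, PIInf}}
     else if r = 2 * n then T1 n \<union> {{MInf, MIInf}, {PInf, PIInf}}
     else if r = 2 * n + 1 then T2 n \<union> {{MInf, PIInf}, {PInf, MIInf}}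
     else rot n (r - 1) ` base2 n)"

end

theory Submission
  imports Defs "HOL-Library.Disjoint_Sets"
begin

text \<open>
  Everything reduces to covering statements by counting. A set of at most $k$ edges that covers
  $2k$ vertices is a one-factor, and at most $2k - 1$ such sets that together contain all
  $k(2k - 1)$ edges are pairwise disjoint. All edges are covered because every cyclic difference
  $1, \ldots, n - 2$ occurs in $E_1 \cup E_2$; in $\mathcal{F}^2$ the rotations of $e^*$,
  which are missing from the first $2n - 2$ rounds, are collected in $T_1$ and $T_2$.
  Every edge of $K_{2n}$ is then a common fixture, except the $2n - 4$ rotations
  $\sigma^k(e^*)$ with $2 \le k < 2n - 2$: for $k = 0, 1$ the congruence modulo $2n - 1$
  identifies the rounds $2n$ and $2n + 1$ with the rounds $1$ and $2$, whereas for the other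
  $k$ it only pairs round $k + 1$ with itself.
\<close>

section \<open>Counting criteria for one-factors and one-factorisations\<close>

text \<open>Only an upper bound on the size is demanded. For a union of images it follows from
  \<open>card_image_le\<close> and \<open>card_Un_le\<close>, with no injectivity to check; that
  edges do not overlap is then a consequence of counting.\<close>

definition tight_cover :: "'a set \<Rightarrow> 'a set set \<Rightarrow> bool" where
  "tight_cover V F \<longleftrightarrow> F \<subseteq> nsets V 2 \<and> 2 * card F \<le> card V \<and> V \<subseteq> \<Union>F"

lemma card_Union_nsets_2_le:
  assumes "finite F" "F \<subseteq> nsets V 2"
  shows "card (\<Union>F) \<le> 2 * card F"
proof -
  have "card (\<Union>F) \<le> (\<Sum>e\<in>F. card e)"
    by (rule card_Union_le_sum_card)
  also have "\<dots> = (\<Sum>e\<in>F. 2)"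
    using assms(2) by (intro sum.cong) (auto simp: nsets_def)
  finally show ?thesis by simp
qed

lemma finite_subset_nsets: "finite V \<Longrightarrow> F \<subseteq> nsets V k \<Longrightarrow> finite F"
  using finite_imp_finite_nsets finite_subset by blast

text \<open>If two different edges met in \<open>v\<close>, then \<open>v\<close> could be dropped
  from one of them without uncovering it, so at most \<open>2 * card F - 1\<close> vertices would be
  covered, fewer than \<open>card V\<close>.\<close>

lemma tight_cover_imp_one_factor:
  assumes "finite V" "tight_cover V F"
  shows "one_factor V (nsets V 2) F"
proof -
  have F: "F \<subseteq> nsets V 2" "2 * card F \<le> card V" "V \<subseteq> \<Union>F"
    using assms(2) by (auto simp: tight_cover_def)
  have fin: "finite F"
    using assms(1) F(1) finite_subset_nsets by blast
  have "e = e'" if "v \<in> V" "e \<in> F" "v \<in> e" "e' \<in> F" "v \<in> e'" for v e e'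
  proof (rule ccontr)
    assume "e \<noteq> e'"
    have e: "finite e" "card e = 2"
      using F(1) that(2) by (auto simp: nsets_def)
    have "V \<subseteq> \<Union>(F - {e}) \<union> (e - {v})"
      using F(3) that \<open>e \<noteq> e'\<close> by auto
    moreover have "finite (\<Union>(F - {e}) \<union> (e - {v}))"
      using fin F(1) e by (auto simp: nsets_def)
    ultimately have "card V \<le> card (\<Union>(F - {e}) \<union> (e - {v}))"
      by (rule card_mono[rotated])
    also have "\<dots> \<le> card (\<Union>(F - {e})) + card (e - {v})"
      by (rule card_Un_le)
    also have "\<dots> \<le> 2 * card (F - {e}) + 1"
      using card_Union_nsets_2_le[of "F - {e}" V] fin F(1) e that by auto
    also have "\<dots> < 2 * card F"
      using fin that(2) card_Suc_Diff1[of F e] by linarith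
    finally show False using F(2) by simp
  qed
  then show ?thesis
    using F by (auto simp: one_factor_def)
qed

lemma tight_cover_image:
  assumes "finite V" "bij_betw f V V" "tight_cover V F"
  shows "tight_cover V ((`) f ` F)"
  unfolding tight_cover_def
proof (intro conjI)
  have F: "F \<subseteq> nsets V 2" "2 * card F \<le> card V" "V \<subseteq> \<Union>F"
    using assms(3) by (auto simp: tight_cover_def)
  have fin: "finite F"
    using assms(1) F(1) finite_subset_nsets by blast
  show "(`) f ` F \<subseteq> nsets V 2"
  proof
    fix e assume "e \<in> (`) f ` F"
    then obtain e0 where e0: "e0 \<in> F" "e = f ` e0" by auto
    with F(1) have "e0 \<subseteq> V" "finite e0" "card e0 = 2" by (auto simp: nsets_def)
    moreover have "card (f ` e0) = card e0"
      using \<open>e0 \<subseteq> V\<close> assms(2) by (meson bij_betw_imp_inj_on card_image inj_on_subset)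
    ultimately show "e \<in> nsets V 2"
      using e0 assms(2) by (auto simp: nsets_def bij_betw_def)
  qed
  show "2 * card ((`) f ` F) \<le> card V"
    using card_image_le[OF fin, of "(`) f"] F(2) by linarith
  show "V \<subseteq> \<Union>((`) f ` F)"
    using image_mono[OF F(3), of f] assms(2) by (simp add: bij_betw_def image_Union)
qed

text \<open>Each member has at most \<open>k = card V div 2\<close> edges. An edge occurring under
  two indices may be deleted from one of them while the union still holds all edges, but then fewer
  than \<open>card R * k\<close>, hence fewer than \<open>card V choose 2\<close>, edges
  remain.\<close>

lemma tight_cover_disjoint_family:
  fixes F :: "'i \<Rightarrow> 'a set set"
  assumes V: "finite V" and R: "finite R" "card R < card V"
    and tc: "\<And>r. r \<in> R \<Longrightarrow> tight_cover V (F r)"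
    and cov: "nsets V 2 \<subseteq> \<Union>(F ` R)"
  shows "disjoint_family_on F R"
proof (rule ccontr)
  assume "\<not> disjoint_family_on F R"
  then obtain r r' e where r: "r \<in> R" "r' \<in> R" "r \<noteq> r'" "e \<in> F r" "e \<in> F r'"
    by (auto simp: disjoint_family_on_def)
  define k where "k = card V div 2"
  have F: "finite (F q)" "card (F q) \<le> k" if "q \<in> R" for q
    using tc[OF that] V finite_subset_nsets[of V "F q" 2] by (auto simp: tight_cover_def k_def)
  \<comment> \<open>The copy of \<open>e\<close> in \<open>F r'\<close> makes the one in
    \<open>F r\<close> redundant.\<close>
  have "nsets V 2 \<subseteq> \<Union>(F ` (R - {r})) \<union> (F r - {e})"
    using cov r by auto
  moreover have "finite (\<Union>(F ` (R - {r})) \<union> (F r - {e}))"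
    using F R r by auto
  ultimately have "card (nsets V 2) \<le> card (\<Union>(F ` (R - {r})) \<union> (F r - {e}))"
    by (rule card_mono[rotated])
  also have "\<dots> \<le> card (\<Union>(F ` (R - {r}))) + card (F r - {e})"
    by (rule card_Un_le)
  also have "card (\<Union>(F ` (R - {r}))) \<le> (\<Sum>q\<in>R - {r}. card (F q))"
    using R(1) by (intro card_UN_le) auto
  also have "\<dots> \<le> (\<Sum>q\<in>R - {r}. k)"
    using F by (intro sum_mono) auto
  also have "\<dots> = (card R - 1) * k"
    using r R by simp
  also have "card (F r - {e}) < card (F r)"
    using F r by (meson card_Diff1_less)
  also have "card (F r) \<le> k"
    using F r by auto
  finally have "card (nsets V 2) < (card R - 1) * k + k" by simp
  also have "\<dots> = card R * k"
    using r R by (metis Suc_diff_1 card_gt_0_iff emptyE mult_Suc add.commute)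
  also have "\<dots> \<le> (card V - 1) * k"
    using R(2) by (intro mult_right_mono) auto
  also have "\<dots> \<le> card V choose 2"
  proof -
    have "(card V - 1) * k * 2 \<le> card V * (card V - 1)"
      by (simp add: k_def)
    then show ?thesis
      unfolding choose_two by linarith
  qed
  finally show False
    by (simp add: card_nsets)
qed

lemma one_factorisation_tight_covers:
  assumes "finite V" "finite R" "card R < card V"
    and tc: "\<And>r. r \<in> R \<Longrightarrow> tight_cover V (F r)"
    and "nsets V 2 \<subseteq> \<Union>(F ` R)"
  shows "one_factorisation V (nsets V 2) (F ` R)"
proof -
  have "disjoint_family_on F R"
    using assms by (rule tight_cover_disjoint_family)
  then have "pairwise disjnt (F ` R)"
    by (auto simp: pairwise_def disjnt_def dest: disjoint_family_onD)
  moreover have "\<Union>(F ` R) = nsets V 2"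
    using assms(5) tc by (intro equalityI UN_least) (auto simp: tight_cover_def)
  moreover have "one_factor V (nsets V 2) (F r)" if "r \<in> R" for r
    using tight_cover_imp_one_factor[OF assms(1) tc[OF that]] .
  ultimately show ?thesis
    by (simp add: one_factorisation_def)
qed

section \<open>The vertex sets and the rotation\<close>

lemma finite_V1: "finite (V1 n)" and finite_V2: "finite (V2 n)"
  by (auto simp: V1_def V2_def)

lemma card_V1: "n \<ge> 3 \<Longrightarrow> card (V1 n) = 2 * n"
proof -
  assume "n \<ge> 3"
  have "card (Num ` {0..2 * n - 3}) = 2 * n - 2"
    using \<open>n \<ge> 3\<close> by (subst card_image) (auto simp: inj_on_def)
  moreover have "card (V1 n) = card (Num ` {0..2 * n - 3}) + card {MInf, PInf}"
    unfolding V1_def by (intro card_Un_disjoint) auto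
  ultimately show ?thesis using \<open>n \<ge> 3\<close> by simp
qed

lemma card_V2: "n \<ge> 3 \<Longrightarrow> card (V2 n) = 2 * n + 2"
proof -
  assume "n \<ge> 3"
  have "card (V2 n) = card (V1 n) + card {MIInf, PIInf}"
    unfolding V2_def using finite_V1 by (intro card_Un_disjoint) (auto simp: V1_def)
  then show ?thesis using \<open>n \<ge> 3\<close> card_V1 by simp
qed

lemma Num_in_V1: "n \<ge> 3 \<Longrightarrow> Num x \<in> V1 n \<longleftrightarrow> x < 2 * n - 2"
  by (auto simp: V1_def)

lemma Num_in_V2: "n \<ge> 3 \<Longrightarrow> Num x \<in> V2 n \<longleftrightarrow> x < 2 * n - 2"
  by (auto simp: V2_def V1_def)

lemma inf_in_V:
  "MInf \<in> V1 n" "PInf \<in> V1 n" "MIInf \<notin> V1 n" "PIInf \<notin> V1 n"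
  "MInf \<in> V2 n" "PInf \<in> V2 n" "MIInf \<in> V2 n" "PIInf \<in> V2 n"
  by (auto simp: V1_def V2_def)

lemma sigma_pow_Num:
  "x < 2 * n - 2 \<Longrightarrow> (\<sigma> n ^^ k) (Num x) = Num ((x + k) mod (2 * n - 2))"
  by (induction k) (auto simp: mod_Suc_eq)

lemma sigma_pow_inf [simp]:
  "(\<sigma> n ^^ k) MInf = MInf" "(\<sigma> n ^^ k) PInf = PInf"
  "(\<sigma> n ^^ k) MIInf = MIInf" "(\<sigma> n ^^ k) PIInf = PIInf"
  by (induction k) auto

text \<open>Transitivity of the cyclic group on residues, used to bring a given end of an edge to a
  given place. The shift is \<open>y + (m - x)\<close> reduced, written so that no subtraction is
  truncated.\<close>

lemma exists_shift:
  fixes m :: nat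
  assumes "x < m" "y < m"
  obtains k where "k < m" "(x + k) mod m = y"
proof -
  have "(x + (y + (m - x)) mod m) mod m = (x + (y + (m - x))) mod m"
    by (rule mod_add_right_eq)
  also have "\<dots> = y"
    using assms by simp
  finally show ?thesis
    using that[of "(y + (m - x)) mod m"] assms by auto
qed

lemma sigma_surj:
  assumes n: "n \<ge> 3"
  shows "V1 n \<subseteq> \<sigma> n ` V1 n" "V2 n \<subseteq> \<sigma> n ` V2 n"
proof -
  have *: "\<exists>x < 2 * n - 2. \<sigma> n (Num x) = Num y" if y: "y < 2 * n - 2" for y
  proof -
    have "1 < 2 * n - 2" using n by linarith
    \<comment> \<open>Here 1 is the point being moved, and the shift that takes it to
      \<open>y\<close> is the preimage of \<open>y\<close>.\<close>
    then obtain x where x: "x < 2 * n - 2" "(1 + x) mod (2 * n - 2) = y"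
      using exists_shift y by blast
    then show ?thesis by (intro exI[of _ x]) auto
  qed
  show "V1 n \<subseteq> \<sigma> n ` V1 n"
  proof
    fix v assume v: "v \<in> V1 n"
    show "v \<in> \<sigma> n ` V1 n"
    proof (cases v)
      case (Num y)
      then have "y < 2 * n - 2" using v n Num_in_V1 by simp
      then obtain x where "x < 2 * n - 2" "\<sigma> n (Num x) = Num y" using * by blast
      then show ?thesis using Num n Num_in_V1 by (metis image_eqI)
    next
      case MInf
      then show ?thesis using inf_in_V(1) by (intro image_eqI[of _ _ MInf]) auto
    next
      case PInf
      then show ?thesis using inf_in_V(2) by (intro image_eqI[of _ _ PInf]) auto
    qed (use v inf_in_V in auto)
  qed
  then show "V2 n \<subseteq> \<sigma> n ` V2 n"
    by (auto simp: V2_def image_iff)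
qed

text \<open>On a finite set surjectivity is enough: the image contains the set and is no larger than
  it, so the two coincide, and equal cardinality gives injectivity.\<close>

lemma bij_betw_sigma_pow:
  assumes n: "n \<ge> 3"
  shows "bij_betw (\<sigma> n ^^ k) (V1 n) (V1 n)" "bij_betw (\<sigma> n ^^ k) (V2 n) (V2 n)"
proof -
  have 1: "\<sigma> n ` V1 n = V1 n"
    by (rule card_seteq[symmetric]) (simp_all add: finite_V1 card_image_le sigma_surj[OF n])
  have 2: "\<sigma> n ` V2 n = V2 n"
    by (rule card_seteq[symmetric]) (simp_all add: finite_V2 card_image_le sigma_surj[OF n])
  have "bij_betw (\<sigma> n) (V1 n) (V1 n)" "bij_betw (\<sigma> n) (V2 n) (V2 n)"
    using 1 2 finite_V1 finite_V2 by (auto simp: bij_betw_def eq_card_imp_inj_on)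
  then show "bij_betw (\<sigma> n ^^ k) (V1 n) (V1 n)" "bij_betw (\<sigma> n ^^ k) (V2 n) (V2 n)"
    by (auto intro: bij_betw_funpow)
qed

lemma rot_add: "rot n (i + j) e = rot n i (rot n j e)"
  by (simp add: rot_def funpow_add image_comp)

lemma rot_doubleton:
  "x < 2 * n - 2 \<Longrightarrow> y < 2 * n - 2 \<Longrightarrow>
    rot n k {Num x, Num y} = {Num ((x + k) mod (2 * n - 2)), Num ((y + k) mod (2 * n - 2))}"
  by (simp add: rot_def sigma_pow_Num)

lemma inj_on_rot:
  assumes "n \<ge> 3"
  shows "inj_on (rot n k) (nsets (V2 n) 2)"
proof -
  have "inj_on ((`) (\<sigma> n ^^ k)) (Pow (V2 n))"
    using bij_betw_sigma_pow(2)[OF assms] by (auto simp: bij_betw_def intro: inj_on_image_Pow)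
  then show ?thesis
    unfolding rot_def[abs_def] by (rule inj_on_subset) (auto simp: nsets_def)
qed

lemma tight_cover_rot:
  assumes "n \<ge> 3"
  shows "tight_cover (V1 n) F \<Longrightarrow> tight_cover (V1 n) (rot n k ` F)"
    "tight_cover (V2 n) G \<Longrightarrow> tight_cover (V2 n) (rot n k ` G)"
  unfolding rot_def[abs_def]
  by (erule tight_cover_image[OF finite_V1 bij_betw_sigma_pow(1)[OF assms]],
      erule tight_cover_image[OF finite_V2 bij_betw_sigma_pow(2)[OF assms]])

section \<open>The base rounds of the two divisions\<close>

lemma tight_coverI:
  assumes "F \<subseteq> nsets V 2" "2 * card F \<le> card V" "\<And>v. v \<in> V \<Longrightarrow> \<exists>e\<in>F. v \<in> e"
  shows "tight_cover V F"
  using assms unfolding tight_cover_def by blast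

text \<open>Shaped for \<open>base1\<close>: \<open>E1\<close> and \<open>E2\<close> are images of
  intervals, and \<open>E3\<close> consists of two edges.\<close>

lemma card_two_images_le:
  assumes "finite A" "finite B"
  shows "card (f ` A \<union> g ` B \<union> {a, b}) \<le> card A + card B + 2"
proof -
  have "card (f ` A \<union> g ` B \<union> {a, b}) \<le> card (f ` A) + card (g ` B) + card {a, b}"
    by (meson add_mono card_Un_le le_trans order_refl)
  also have "\<dots> \<le> card A + card B + 2"
    by (intro add_mono card_image_le assms) (simp add: card_insert_if)
  finally show ?thesis .
qed

text \<open>A form of membership symmetric in both ends: \<open>s_idx n\<close> is the largest
  integer strictly below \<open>(n - 2) / 2\<close>, so the smaller end always lies in the index
  range. \<open>E2_I\<close> does the same with \<open>u_idx n\<close> and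
  \<open>(3 * n - 5) / 2\<close>.\<close>

lemma E1_I:
  assumes "x + y + 2 = n" "x \<noteq> y"
  shows "{Num x, Num y} \<in> E1 n"
proof -
  have *: "{Num a, Num b} \<in> E1 n" if ab: "a + b + 2 = n" "a < b" for a b
  proof -
    have "a \<le> s_idx n" using ab unfolding s_idx_def by presburger
    moreover have "b = n - 2 - a" using ab by linarith
    ultimately show ?thesis unfolding E1_def by (intro image_eqI[of _ _ a]) simp_all
  qed
  show ?thesis
    using *[of x y] *[of y x] assms by (cases "x < y") (simp_all add: insert_commute)
qed

lemma E2_I:
  assumes "x + y + 5 = 3 * n" "x \<noteq> y" "n \<le> x + 1" "n \<le> y + 1"
  shows "{Num x, Num y} \<in> E2 n"
proof -
  have *: "{Num a, Num b} \<in> E2 n" if ab: "a + b + 5 = 3 * n" "a < b" "n \<le> a + 1" for a b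
  proof -
    have "a \<le> u_idx n" using ab unfolding u_idx_def by presburger
    moreover have "n - 1 \<le> a" "b = 3 * n - 5 - a" using ab by linarith+
    ultimately show ?thesis unfolding E2_def by (intro image_eqI[of _ _ a]) simp_all
  qed
  show ?thesis
    using *[of x y] *[of y x] assms by (cases "x < y") (simp_all add: insert_commute)
qed

text \<open>This and \<open>u_idx_le\<close> keep the indices below the midpoints
  \<open>(n - 2) / 2\<close> and \<open>(3 * n - 5) / 2\<close>: no edge of \<open>E1\<close> or
  \<open>E2\<close> degenerates, and the number of edges is bounded.\<close>

lemma s_idx_le: "n \<ge> 3 \<Longrightarrow> 2 * s_idx n + 3 \<le> n"
  by (cases "even n") (auto simp: s_idx_def elim!: evenE oddE)

lemma u_idx_le: "n \<ge> 3 \<Longrightarrow> 2 * u_idx n + 6 \<le> 3 * n"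
  unfolding u_idx_def by simp

lemma E1_subset:
  assumes n: "n \<ge> 3"
  shows "E1 n \<subseteq> nsets (V1 n) 2"
proof -
  have "x < 2 * n - 2" "n - 2 - x < 2 * n - 2" "x \<noteq> n - 2 - x" if "x \<le> s_idx n" for x
    using n that s_idx_le[OF n] by linarith+
  then show ?thesis using n by (auto simp: E1_def doubleton_in_nsets_2 Num_in_V1)
qed

lemma E2_subset:
  assumes n: "n \<ge> 3"
  shows "E2 n \<subseteq> nsets (V1 n) 2"
proof -
  have "x < 2 * n - 2" "3 * n - 5 - x < 2 * n - 2" "x \<noteq> 3 * n - 5 - x"
    if "n - 1 \<le> x" "x \<le> u_idx n" for x
    using n that u_idx_le[OF n] by linarith+
  then show ?thesis using n by (auto simp: E2_def doubleton_in_nsets_2 Num_in_V1)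
qed

lemma E3_subset:
  assumes n: "n \<ge> 3"
  shows "E3 n \<subseteq> nsets (V1 n) 2"
proof -
  have "(n - 2) div 2 < 2 * n - 2" "(3 * n - 5) div 2 < 2 * n - 2" "2 * n - 3 < 2 * n - 2"
    using n by linarith+
  then show ?thesis
    unfolding E3_def using n by (simp add: doubleton_in_nsets_2 Num_in_V1 inf_in_V)
qed

text \<open>\<open>E1\<close> reflects the interval from 0 to \<open>n - 2\<close>, and
  \<open>E2\<close> the one from \<open>n - 1\<close> to \<open>2 * n - 4\<close>. Exactly one of
  these has odd length, depending on the parity of \<open>n\<close>; its midpoint is joined to
  \<open>MInf\<close>, and the remaining \<open>2 * n - 3\<close> to \<open>PInf\<close>.\<close>

lemma tight_cover_base1:
  assumes n: "n \<ge> 3"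
  shows "tight_cover (V1 n) (base1 n)"
proof (rule tight_coverI)
  show "base1 n \<subseteq> nsets (V1 n) 2"
    using E1_subset[OF n] E2_subset[OF n] E3_subset[OF n] by (simp add: base1_def)
  obtain e e' where "E3 n = {e, e'}" unfolding E3_def by (cases "even n") auto
  then have "card (base1 n) \<le> card {0..s_idx n} + card {n - 1..u_idx n} + 2"
    unfolding base1_def E1_def E2_def by (simp only:) (rule card_two_images_le; simp)
  \<comment> \<open>The two index bounds add up to \<open>2 * (s + u) <= 4 * n - 9\<close>. The
    right-hand side is odd, so \<open>s + u <= 2 * n - 5\<close>, which is exactly enough.\<close>
  also have "\<dots> \<le> n"
    using n s_idx_le[OF n] u_idx_le[OF n] unfolding card_atLeastAtMost by linarith
  finally show "2 * card (base1 n) \<le> card (V1 n)" using n card_V1 by simp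
  fix v assume v: "v \<in> V1 n"
  show "\<exists>e\<in>base1 n. v \<in> e"
  proof (cases v)
    case (Num x)
    then have "x < 2 * n - 2" using v n Num_in_V1 by simp
    then consider "x + 2 \<le> n" | "n \<le> x + 1" "x + 4 \<le> 2 * n" | "x = 2 * n - 3" by linarith
    then show ?thesis
    proof cases
      case 1
      define y where "y = n - 2 - x"
      have y: "x + y + 2 = n" using 1 by (simp add: y_def)
      show ?thesis
      proof (cases "x = y")
        case True
        then have "even n" "x = (n - 2) div 2" using y by presburger+
        then have "{Num x, MInf} \<in> base1 n" by (simp add: base1_def E3_def)
        then show ?thesis using Num by blast
      next
        case False
        then have "{Num x, Num y} \<in> base1 n" unfolding base1_def using E1_I[OF y] by blast
        then show ?thesis using Num by blast
      qed
    next
      case 2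
      define y where "y = 3 * n - 5 - x"
      have y: "x + y + 5 = 3 * n" "n \<le> y + 1" using 2 n unfolding y_def by linarith+
      show ?thesis
      proof (cases "x = y")
        case True
        then have "3 * n = 2 * x + 5" using y by simp
        then have "odd (3 * n)" "x = (3 * n - 5) div 2" by simp_all
        then have "odd n" "x = (3 * n - 5) div 2" by simp_all
        then have "{Num x, MInf} \<in> base1 n" by (simp add: base1_def E3_def)
        then show ?thesis using Num by blast
      next
        case False
        then have "{Num x, Num y} \<in> base1 n" unfolding base1_def using E2_I[OF y(1) _ 2(1) y(2)] by blast
        then show ?thesis using Num by blast
      qed
    next
      case 3
      then have "{Num x, PInf} \<in> base1 n" by (simp add: base1_def E3_def)
      then show ?thesis using Num by blast
    qed
  qed (use v in \<open>auto simp: base1_def E3_def inf_in_V\<close>)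
qed

text \<open>The ends of a chord in \<open>E1\<close> sum to \<open>n - 2\<close>, those in
  \<open>E2\<close> to \<open>3 * n - 5\<close>. So \<open>E1\<close> supplies the differences with
  the parity of \<open>n\<close> and \<open>E2\<close> the others; the left end \<open>l\<close>
  solves \<open>l + (l + d) = n - 2\<close> or \<open>l + (l + d) = 3 * n - 5\<close>.\<close>

lemma chord_in_base1:
  assumes n: "n \<ge> 3" and d: "1 \<le> d" "d \<le> n - 2"
  obtains l where "l + d < 2 * n - 2" "{Num l, Num (l + d)} \<in> base1 n"
proof (cases "even n = even d")
  case True
  define l where "l = (n - 2 - d) div 2"
  have "even (n - 2 - d)" using True d by simp
  then have "2 * l = n - 2 - d" by (simp add: l_def)
  then have "l + (l + d) + 2 = n" using n d by linarith
  then show ?thesis using that[of l] E1_I[of l "l + d" n] d by (simp add: base1_def)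
next
  case False
  define l where "l = (3 * n - 5 - d) div 2"
  have "even (3 * n - 5 - d)" using False d n by simp
  then have "2 * l = 3 * n - 5 - d" by (simp add: l_def)
  \<comment> \<open>Parity gives \<open>d <= n - 3\<close>, which keeps \<open>l\<close> at or above
    \<open>n - 1\<close>, inside the interval of \<open>E2\<close>.\<close>
  moreover have "d \<noteq> n - 2" using False n by auto
  ultimately have "l + (l + d) + 5 = 3 * n" "n \<le> l + 1" using n d by linarith+
  then show ?thesis using that[of l] E2_I[of l "l + d" n] d by (simp add: base1_def)
qed

text \<open>Removes the parity split from all that follows: in both cases the removed edge is a
  chord of difference 1, and the spokes of \<open>E4\<close> start at its two ends.\<close>

lemma e_star_E4:
  assumes n: "n \<ge> 3"
  obtains a where "a + 1 < 2 * n - 2" "e_star n = {Num a, Num (a + 1)}"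
    "E4 n = {{Num a, MIInf}, {Num (a + 1), PIInf}}" "e_star n \<in> base1 n"
proof (cases "even n")
  case True
  \<comment> \<open>The bound 4 is what places \<open>u_idx n\<close> at or above
    \<open>n - 1\<close>.\<close>
  have "even (3 * n - 6)" "n \<ge> 4" using True n by (auto simp: le_eq_less_or_eq)
  then have "2 * u_idx n = 3 * n - 6" using True by (simp add: u_idx_def)
  then have *: "v_idx n = u_idx n + 1" "u_idx n + (u_idx n + 1) + 5 = 3 * n" "n \<le> u_idx n + 1"
    using \<open>n \<ge> 4\<close> unfolding v_idx_def by linarith+
  then have "e_star n \<in> E2 n"
    using True E2_I[of "u_idx n" "u_idx n + 1" n] by (simp add: e_star_def)
  then show ?thesis
    using that[of "u_idx n"] * True by (simp add: e_star_def E4_def base1_def)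
next
  case False
  have "even (n - 3)" using False n by simp
  then have "2 * s_idx n = n - 3" using False by (simp add: s_idx_def)
  then have *: "t_idx n = s_idx n + 1" "s_idx n + (s_idx n + 1) + 2 = n"
    using n unfolding t_idx_def by linarith+
  then have "e_star n \<in> E1 n"
    using False E1_I[of "s_idx n" "s_idx n + 1" n] by (simp add: e_star_def)
  then show ?thesis
    using that[of "s_idx n"] * False by (simp add: e_star_def E4_def base1_def)
qed

text \<open>Removing \<open>e_star n\<close> uncovers just its two ends, which \<open>E4\<close>
  joins to the two new vertices. Edges grow by at most one and vertices by two.\<close>

lemma tight_cover_base2:
  assumes n: "n \<ge> 3"
  shows "tight_cover (V2 n) (base2 n)"
proof (rule tight_coverI)
  from e_star_E4[OF n] obtain a where a: "a + 1 < 2 * n - 2" "e_star n = {Num a, Num (a + 1)}"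
    "E4 n = {{Num a, MIInf}, {Num (a + 1), PIInf}}" "e_star n \<in> base1 n" .
  have b: "base1 n \<subseteq> nsets (V1 n) 2" "2 * card (base1 n) \<le> card (V1 n)" "V1 n \<subseteq> \<Union>(base1 n)"
    using tight_cover_base1[OF n] by (auto simp: tight_cover_def)
  have fin: "finite (base1 n)" using b(1) finite_V1 finite_subset_nsets by blast
  have "V1 n \<subseteq> V2 n" by (auto simp: V2_def)
  then have "base1 n \<subseteq> nsets (V2 n) 2" using b(1) nsets_mono by blast
  then show "base2 n \<subseteq> nsets (V2 n) 2"
    using a n by (auto simp: base2_def doubleton_in_nsets_2 Num_in_V2 inf_in_V)
  \<comment> \<open>The deletion lowers the cardinality because \<open>e_star n\<close> really
    belongs to \<open>base1 n\<close>.\<close>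
  have "card (base2 n) = card (base1 n \<union> E4 n) - 1"
    unfolding base2_def using a fin by (subst card_Diff_singleton) auto
  moreover have "card (base1 n \<union> E4 n) \<le> card (base1 n) + card (E4 n)"
    by (rule card_Un_le)
  moreover have "card (E4 n) \<le> 2"
    unfolding a(3) by (simp add: card_insert_if)
  ultimately have "card (base2 n) \<le> card (base1 n) + 1" by linarith
  then show "2 * card (base2 n) \<le> card (V2 n)"
    using b(2) card_V1[OF n] card_V2[OF n] by linarith
  fix v assume v: "v \<in> V2 n"
  show "\<exists>e\<in>base2 n. v \<in> e"
  proof (cases "v \<in> {Num a, Num (a + 1), MIInf, PIInf}")
    case True
    then show ?thesis using a by (auto simp: base2_def doubleton_eq_iff)
  next
    case False
    then have "v \<in> V1 n" using v by (auto simp: V2_def)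
    then obtain e where "e \<in> base1 n" "v \<in> e" using b(3) by auto
    moreover from this have "e \<noteq> e_star n" using False a by auto
    ultimately show ?thesis by (auto simp: base2_def)
  qed
qed

section \<open>The round of diameters and the two rounds built from rotations of the removed
  edge\<close>

lemma tight_cover_diam1:
  assumes n: "n \<ge> 3"
  shows "tight_cover (V1 n) (diam1 n)"
proof (rule tight_coverI)
  show "diam1 n \<subseteq> nsets (V1 n) 2"
    using n by (auto simp: diam1_def doubleton_in_nsets_2 Num_in_V1 inf_in_V)
  have "card (diam1 n) \<le> card ((\<lambda>x. {Num x, Num (x + n - 1)}) ` {0..n - 2}) + card {{MInf, PInf}}"
    unfolding diam1_def by (rule card_Un_le)
  also have "\<dots> \<le> card {0..n - 2} + 1"
    by (intro add_mono card_image_le) auto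
  finally show "2 * card (diam1 n) \<le> card (V1 n)"
    using n card_V1 by simp
  fix v assume v: "v \<in> V1 n"
  show "\<exists>e\<in>diam1 n. v \<in> e"
  proof (cases v)
    case (Num x)
    then have x: "x < 2 * n - 2" using v n Num_in_V1 by simp
    show ?thesis
    proof (cases "x \<le> n - 2")
      case False
      then have "x - (n - 1) \<in> {0..n - 2}" "x = x - (n - 1) + n - 1" using x n by auto
      then have "{Num (x - (n - 1)), Num x} \<in> diam1 n"
        unfolding diam1_def by (intro UnI1 image_eqI[of _ _ "x - (n - 1)"]) metis+
      then show ?thesis using Num by blast
    qed (use Num in \<open>auto simp: diam1_def\<close>)
  qed (use v in \<open>auto simp: diam1_def inf_in_V\<close>)
qed

lemma tight_cover_insert_MIInf_PIInf:
  assumes n: "n \<ge> 3" and "tight_cover (V1 n) F"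
  shows "tight_cover (V2 n) (F \<union> {{MIInf, PIInf}})"
proof (rule tight_coverI)
  have F: "F \<subseteq> nsets (V1 n) 2" "2 * card F \<le> card (V1 n)" "V1 n \<subseteq> \<Union>F"
    using assms(2) by (auto simp: tight_cover_def)
  have "V1 n \<subseteq> V2 n" by (auto simp: V2_def)
  then have "F \<subseteq> nsets (V2 n) 2" using F(1) nsets_mono by blast
  then show "F \<union> {{MIInf, PIInf}} \<subseteq> nsets (V2 n) 2"
    by (auto simp: doubleton_in_nsets_2 inf_in_V)
  show "2 * card (F \<union> {{MIInf, PIInf}}) \<le> card (V2 n)"
    using card_Un_le[of F "{{MIInf, PIInf}}"] F(2) n card_V1 card_V2 by simp
  fix v assume "v \<in> V2 n"
  then show "\<exists>e\<in>F \<union> {{MIInf, PIInf}}. v \<in> e" using F(3) by (auto simp: V2_def)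
qed

lemma rot_in_nsets_V1:
  assumes "n \<ge> 3" "e \<in> nsets (V1 n) 2"
  shows "rot n k e \<in> nsets (V1 n) 2"
proof -
  have "card ((\<sigma> n ^^ k) ` e) = card e"
    using assms bij_betw_sigma_pow(1)[OF assms(1), of k]
    by (intro card_image) (auto simp: bij_betw_def nsets_def intro: inj_on_subset)
  then show ?thesis
    using assms bij_betw_sigma_pow(1)[OF assms(1), of k] by (auto simp: rot_def nsets_def bij_betw_def)
qed

text \<open>Even rotations of a chord of difference 1 reach every residue: its two ends have
  opposite parity, and one of them differs from \<open>x\<close> by an even shift.\<close>

lemma T1_covers:
  assumes n: "n \<ge> 3" and x: "x < 2 * n - 2"
  shows "\<exists>e\<in>T1 n. Num x \<in> e"
proof -
  from e_star_E4[OF n] obtain a where a: "a + 1 < 2 * n - 2" "e_star n = {Num a, Num (a + 1)}"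
    "E4 n = {{Num a, MIInf}, {Num (a + 1), PIInf}}" "e_star n \<in> base1 n" .
  have "a < 2 * n - 2" using a by simp
  then obtain k where k: "k < 2 * n - 2" "(a + k) mod (2 * n - 2) = x"
    using exists_shift x by blast
  have *: "\<exists>e\<in>T1 n. Num x \<in> e"
    if kj: "k' = 2 * j" "j \<le> n - 2" "b \<in> {a, a + 1}" "(b + k') mod (2 * n - 2) = x" for k' j b
  proof (rule bexI)
    show "rot n k' (e_star n) \<in> T1 n" using kj by (auto simp: T1_def)
    have "rot n k' (e_star n) =
        {Num ((a + k') mod (2 * n - 2)), Num ((a + 1 + k') mod (2 * n - 2))}"
      unfolding a(2) using a(1) by (intro rot_doubleton) simp_all
    then show "Num x \<in> rot n k' (e_star n)" using kj(3,4) by blast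
  qed
  show "\<exists>e\<in>T1 n. Num x \<in> e"
  proof (cases "even k")
    case True
    then show ?thesis using *[of k "k div 2" a] k by auto
  next
    case False
    \<comment> \<open>Shifting \<open>a\<close> by an odd \<open>k\<close> is shifting
      \<open>a + 1\<close> by the even \<open>k - 1\<close>.\<close>
    then have "1 \<le> k" "k - 1 = 2 * ((k - 1) div 2)" by presburger+
    then show ?thesis using *[of "k - 1" "(k - 1) div 2" "a + 1"] k by auto
  qed
qed

lemma e_star_in_base1: "n \<ge> 3 \<Longrightarrow> e_star n \<in> base1 n"
  by (erule e_star_E4)

lemma T1_subset:
  assumes n: "n \<ge> 3"
  shows "T1 n \<subseteq> nsets (V1 n) 2"
proof -
  have "e_star n \<in> nsets (V1 n) 2"
    using tight_cover_base1[OF n] e_star_in_base1[OF n] by (auto simp: tight_cover_def)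
  then show ?thesis
    unfolding T1_def by (intro image_subsetI rot_in_nsets_V1[OF n])
qed

lemma T2_subset:
  assumes n: "n \<ge> 3"
  shows "T2 n \<subseteq> nsets (V1 n) 2"
  unfolding T2_def using T1_subset[OF n] by (intro image_subsetI rot_in_nsets_V1[OF n]) auto

lemma T2_covers:
  assumes n: "n \<ge> 3" and x: "x < 2 * n - 2"
  shows "\<exists>e\<in>T2 n. Num x \<in> e"
proof -
  have "Num x \<in> \<sigma> n ` V1 n" using sigma_surj(1)[OF n] x n Num_in_V1 by blast
  then obtain v where v: "v \<in> V1 n" "\<sigma> n v = Num x" by auto
  then obtain y where "v = Num y" by (cases v) auto
  then obtain e where "e \<in> T1 n" "v \<in> e" using T1_covers[OF n] v n Num_in_V1 by blast
  then have "rot n 1 e \<in> T2 n" "Num x \<in> rot n 1 e"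
    using v(2)[symmetric] by (auto simp: T2_def rot_def)
  then show ?thesis by blast
qed

text \<open>Stated for either matching of the four symbols, so that it serves both rounds
  \<open>2 * n\<close> and \<open>2 * n + 1\<close>. There are at most \<open>n - 1\<close> chords
  and two further edges for \<open>2 * n + 2\<close> vertices.\<close>

lemma tight_cover_T:
  assumes n: "n \<ge> 3" and T: "T = T1 n \<or> T = T2 n"
    and pq: "{p, q} = {MIInf, PIInf}"
  shows "tight_cover (V2 n) (T \<union> {{MInf, p}, {PInf, q}})"
proof (rule tight_coverI)
  have "T \<subseteq> nsets (V1 n) 2" using T T1_subset[OF n] T2_subset[OF n] by auto
  moreover have "V1 n \<subseteq> V2 n" by (auto simp: V2_def)
  ultimately have "T \<subseteq> nsets (V2 n) 2" using nsets_mono by blast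
  then show "T \<union> {{MInf, p}, {PInf, q}} \<subseteq> nsets (V2 n) 2"
    using pq by (auto simp: doubleton_in_nsets_2 inf_in_V doubleton_eq_iff)
  have "card (T1 n) \<le> card {0..n - 2}" unfolding T1_def by (rule card_image_le) auto
  moreover have "card (T2 n) \<le> card (T1 n)" unfolding T2_def by (rule card_image_le) (simp add: T1_def)
  ultimately have "card T \<le> n - 1" using n T by auto
  moreover have "card (T \<union> {{MInf, p}, {PInf, q}}) \<le> card T + card {{MInf, p}, {PInf, q}}"
    by (rule card_Un_le)
  moreover have "card {{MInf, p}, {PInf, q}} \<le> 2" by (simp add: card_insert_if)
  ultimately show "2 * card (T \<union> {{MInf, p}, {PInf, q}}) \<le> card (V2 n)"
    using n card_V2[OF n] by linarith
  fix v assume v: "v \<in> V2 n"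
  show "\<exists>e\<in>T \<union> {{MInf, p}, {PInf, q}}. v \<in> e"
  proof (cases v)
    case (Num x)
    then have "x < 2 * n - 2" using v n Num_in_V2 by simp
    then have "\<exists>e\<in>T. Num x \<in> e" using T T1_covers[OF n] T2_covers[OF n] by (elim disjE) simp_all
    then show ?thesis using Num by blast
  qed (use pq in \<open>auto simp: doubleton_eq_iff\<close>)
qed

section \<open>The rounds, and the covering of all edges\<close>

lemma F1_base:
  assumes "r < 2 * n - 2"
  shows "F1 n (Suc r) = rot n r ` base1 n"
proof -
  have "Suc r \<noteq> 2 * n - 1" using assms by linarith
  then show ?thesis by (simp add: F1_def)
qed

lemma F2_base:
  assumes "r < 2 * n - 2"
  shows "F2 n (Suc r) = rot n r ` base2 n"
proof -
  have "Suc r \<noteq> 2 * n - 1" "Suc r \<noteq> 2 * n" "Suc r \<noteq> 2 * n + 1" using assms by linarith+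
  then show ?thesis by (simp only: F2_def if_False diff_Suc_1)
qed

lemma tight_cover_F1:
  assumes "n \<ge> 3"
  shows "tight_cover (V1 n) (F1 n r)"
  unfolding F1_def
  using tight_cover_rot(1)[OF assms tight_cover_base1[OF assms]] tight_cover_diam1[OF assms] by simp

lemma tight_cover_F2:
  assumes n: "n \<ge> 3"
  shows "tight_cover (V2 n) (F2 n r)"
proof -
  have "tight_cover (V2 n) (T1 n \<union> {{MInf, MIInf}, {PInf, PIInf}})"
    "tight_cover (V2 n) (T2 n \<union> {{MInf, PIInf}, {PInf, MIInf}})"
    using tight_cover_T[OF n, of "T1 n" MIInf PIInf] tight_cover_T[OF n, of "T2 n" PIInf MIInf]
    by (simp_all add: insert_commute)
  then show ?thesis
    unfolding F2_def using tight_cover_rot(2)[OF n] tight_cover_base2[OF n]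
      tight_cover_insert_MIInf_PIInf[OF n tight_cover_diam1[OF n]] by simp
qed

text \<open>Take the base chord of difference \<open>d\<close> and rotate its left end to
  \<open>x\<close>; the right end then lands \<open>d\<close> places further on.\<close>

lemma oriented_chord_in_rot_base1:
  assumes n: "n \<ge> 3" and d: "1 \<le> d" "d \<le> n - 2" and x: "x < 2 * n - 2"
  obtains k where "k < 2 * n - 2" "{Num x, Num ((x + d) mod (2 * n - 2))} \<in> rot n k ` base1 n"
proof -
  obtain l where l: "l + d < 2 * n - 2" "{Num l, Num (l + d)} \<in> base1 n"
    using chord_in_base1[OF n d] by blast
  have "l < 2 * n - 2" using l by simp
  then obtain k where k: "k < 2 * n - 2" "(l + k) mod (2 * n - 2) = x"
    using exists_shift x by blast
  have "(l + d + k) mod (2 * n - 2) = ((l + k) mod (2 * n - 2) + d) mod (2 * n - 2)"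
    by (simp only: mod_add_left_eq add.assoc add.commute[of d k])
  then have "rot n k {Num l, Num (l + d)} = {Num x, Num ((x + d) mod (2 * n - 2))}"
    using k l by (simp add: rot_doubleton)
  then show thesis using that k l by (metis image_eqI)
qed

lemma chord_covered_F1:
  assumes n: "n \<ge> 3" and xy: "x < y" "y < 2 * n - 2"
  shows "\<exists>r\<in>{1..2 * n - 1}. {Num x, Num y} \<in> F1 n r"
proof -
  have rounds: "\<exists>r\<in>{1..2 * n - 1}. e \<in> F1 n r" if "k < 2 * n - 2" "e \<in> rot n k ` base1 n" for k e
    using that F1_base[of k n] by (intro bexI[of _ "Suc k"]) auto
  consider "y - x \<le> n - 2" | "y - x = n - 1" | "n \<le> y - x" by linarith
  then show ?thesis
  proof cases
    case 1
    have "(x + (y - x)) mod (2 * n - 2) = y" "1 \<le> y - x" "x < 2 * n - 2" using xy by simp_all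
    then obtain k where "k < 2 * n - 2" "{Num x, Num y} \<in> rot n k ` base1 n"
      using oriented_chord_in_rot_base1[OF n _ 1] by metis
    then show ?thesis by (rule rounds)
  next
    case 2
    then have "y = x + n - 1" "x \<le> n - 2" using xy by linarith+
    then have "{Num x, Num y} \<in> diam1 n"
      unfolding diam1_def by (intro UnI1 image_eqI[of _ _ x]) simp_all
    then show ?thesis using n by (intro bexI[of _ "2 * n - 1"]) (auto simp: F1_def)
  next
    case 3
    \<comment> \<open>A long difference is read the other way round the circle, from
      \<open>y\<close> to \<open>x\<close>, where it is at most \<open>n - 2\<close>.\<close>
    have "y + (2 * n - 2 - (y - x)) = x + (2 * n - 2)" using xy by linarith
    then have "(y + (2 * n - 2 - (y - x))) mod (2 * n - 2) = x"
      using xy by (simp only: mod_add_self2) simp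
    moreover have "1 \<le> 2 * n - 2 - (y - x)" "2 * n - 2 - (y - x) \<le> n - 2" using 3 xy by linarith+
    ultimately obtain k where "k < 2 * n - 2" "{Num y, Num x} \<in> rot n k ` base1 n"
      using oriented_chord_in_rot_base1[OF n _ _ xy(2)] by metis
    then show ?thesis using rounds by (simp add: insert_commute)
  qed
qed

text \<open>The symbol \<open>p\<close> is fixed by the rotation, so a single spoke at
  \<open>p\<close> sweeps out all of them.\<close>

lemma spoke_in_rot:
  assumes "{Num a, p} \<in> B" "p \<in> {MInf, PInf, MIInf, PIInf}" "a < 2 * n - 2" "x < 2 * n - 2"
  obtains k where "k < 2 * n - 2" "{Num x, p} \<in> rot n k ` B"
proof -
  obtain k where k: "k < 2 * n - 2" "(a + k) mod (2 * n - 2) = x"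
    using exists_shift assms by blast
  then have "rot n k {Num a, p} = {Num x, p}"
    using assms by (auto simp: rot_def sigma_pow_Num)
  then show thesis using that k assms by (metis image_eqI)
qed

lemma spoke_in_base1:
  assumes n: "n \<ge> 3" and p: "p \<in> {MInf, PInf}"
  obtains a where "a < 2 * n - 2" "{Num a, p} \<in> base1 n"
proof -
  have "(n - 2) div 2 < 2 * n - 2" "(3 * n - 5) div 2 < 2 * n - 2" "2 * n - 3 < 2 * n - 2"
    using n by linarith+
  moreover have "\<exists>a\<in>{(n - 2) div 2, (3 * n - 5) div 2, 2 * n - 3}. {Num a, p} \<in> base1 n"
    using p by (auto simp: base1_def E3_def)
  ultimately show thesis using that by blast
qed

lemma F1_covers:
  assumes n: "n \<ge> 3"
  shows "nsets (V1 n) 2 \<subseteq> \<Union>(F1 n ` {1..2 * n - 1})"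
proof
  define C where "C = \<Union>(F1 n ` {1..2 * n - 1})"
  have C_base: "e \<in> C" if "k < 2 * n - 2" "e \<in> rot n k ` base1 n" for k e
    unfolding C_def using that F1_base[of k n] by (intro UN_I[of "Suc k"]) simp_all
  have chord: "{Num x, Num y} \<in> C" if "x < 2 * n - 2" "y < 2 * n - 2" "x \<noteq> y" for x y
    using chord_covered_F1[OF n, of x y] chord_covered_F1[OF n, of y x] that
    unfolding C_def by (cases "x < y") (simp_all add: insert_commute)
  have spoke: "{Num x, p} \<in> C" if xp: "x < 2 * n - 2" "p \<in> {MInf, PInf}" for x p
  proof -
    obtain a where a: "a < 2 * n - 2" "{Num a, p} \<in> base1 n" using spoke_in_base1[OF n xp(2)] .
    have "p \<in> {MInf, PInf, MIInf, PIInf}" using xp by blast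
    then obtain k where "k < 2 * n - 2" "{Num x, p} \<in> rot n k ` base1 n"
      using spoke_in_rot[OF a(2) _ a(1) xp(1)] by metis
    then show ?thesis by (rule C_base)
  qed
  have "{MInf, PInf} \<in> F1 n (2 * n - 1)" by (simp add: F1_def diam1_def)
  then have inf: "{MInf, PInf} \<in> C" unfolding C_def using n by (intro UN_I) simp_all
  fix e assume "e \<in> nsets (V1 n) 2"
  then obtain v w where e: "e = {v, w}" "v \<in> V1 n" "w \<in> V1 n" "v \<noteq> w"
    by (auto simp: nsets_2_eq)
  have "{v, w} \<in> C"
  proof (cases v)
    case (Num x)
    then show ?thesis
      using e n chord spoke by (cases w) (simp_all add: Num_in_V1 inf_in_V)
  next
    case MInf
    then show ?thesis
      using e n spoke inf by (cases w) (simp_all add: Num_in_V1 inf_in_V insert_commute)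
  next
    case PInf
    then show ?thesis
      using e n spoke inf by (cases w) (simp_all add: Num_in_V1 inf_in_V insert_commute)
  qed (use e inf_in_V in simp_all)
  then show "e \<in> \<Union>(F1 n ` {1..2 * n - 1})" using e by (simp add: C_def)
qed

lemma base1_subset_base2: "base1 n - {e_star n} \<subseteq> base2 n"
  by (auto simp: base2_def)

text \<open>Passing from \<open>base1\<close> to \<open>base2\<close> discards only
  \<open>e_star n\<close>, so only its rotation can be missing from the round of the same
  number.\<close>

lemma F1_edge_in_F2:
  assumes n: "n \<ge> 3" and r: "r \<in> {1..2 * n - 1}" and e: "e \<in> F1 n r"
    and ne: "r < 2 * n - 1 \<Longrightarrow> e \<noteq> rot n (r - 1) (e_star n)"
  shows "e \<in> F2 n r"
proof (cases "r = 2 * n - 1")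
  case True
  then show ?thesis using e by (simp add: F1_def F2_def)
next
  case False
  then have r': "r < 2 * n - 1" "r - 1 < 2 * n - 2" "Suc (r - 1) = r" using r by auto
  then obtain b where "b \<in> base1 n" "e = rot n (r - 1) b" using e F1_base[of "r - 1" n] by auto
  moreover from this have "b \<noteq> e_star n" using ne r' by auto
  ultimately have "e \<in> rot n (r - 1) ` base2 n" using base1_subset_base2 by blast
  then show ?thesis using F2_base[OF r'(2)] r'(3) by simp
qed

lemma rot_e_star_in_T1:
  assumes "even k" "k < 2 * n - 2"
  shows "rot n k (e_star n) \<in> T1 n"
proof -
  have "k div 2 \<in> {0..n - 2}" "2 * (k div 2) = k" using assms by auto
  then show ?thesis unfolding T1_def by (metis (no_types, lifting) image_eqI)
qed

lemma rot_e_star_in_T2: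
  assumes "odd k" "k < 2 * n - 2"
  shows "rot n k (e_star n) \<in> T2 n"
proof -
  have "rot n (k - 1) (e_star n) \<in> T1 n" using assms by (intro rot_e_star_in_T1) auto
  moreover have "rot n k (e_star n) = rot n 1 (rot n (k - 1) (e_star n))"
    unfolding rot_add[symmetric] using assms by (simp add: odd_pos)
  ultimately show ?thesis by (simp add: T2_def)
qed

lemma F2_T1: "n \<ge> 3 \<Longrightarrow> F2 n (2 * n) = T1 n \<union> {{MInf, MIInf}, {PInf, PIInf}}"
  by (simp add: F2_def) linarith

lemma F2_T2: "F2 n (2 * n + 1) = T2 n \<union> {{MInf, PIInf}, {PInf, MIInf}}"
  by (simp add: F2_def) linarith

text \<open>Edges inside \<open>V1 n\<close> come from \<open>F1_covers\<close>, with rotations of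
  \<open>e_star n\<close> recovered from \<open>T1\<close> and \<open>T2\<close>. Spokes at the new
  symbols are rotations of \<open>E4\<close>, and the edges among the four symbols lie in the last
  three rounds, \<open>{MInf, PInf}\<close> being a \<open>V1 n\<close> edge.\<close>

lemma F2_covers:
  assumes n: "n \<ge> 3"
  shows "nsets (V2 n) 2 \<subseteq> \<Union>(F2 n ` {1..2 * n + 1})"
proof
  define C where "C = \<Union>(F2 n ` {1..2 * n + 1})"
  have C_I: "e \<in> C" if "e \<in> F2 n r" "1 \<le> r" "r \<le> 2 * n + 1" for e r
    unfolding C_def using that by auto
  have T: "T1 n \<union> {{MInf, MIInf}, {PInf, PIInf}} \<subseteq> C" "T2 n \<union> {{MInf, PIInf}, {PInf, MIInf}} \<subseteq> C"
    using C_I[of _ "2 * n"] C_I[of _ "2 * n + 1"] n unfolding F2_T1[OF n] F2_T2 by auto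
  have V1: "e \<in> C" if e: "e \<in> nsets (V1 n) 2" for e
  proof -
    obtain r where r: "r \<in> {1..2 * n - 1}" "e \<in> F1 n r"
      using F1_covers[OF n] e by blast
    show ?thesis
    proof (cases "r < 2 * n - 1 \<and> e = rot n (r - 1) (e_star n)")
      case True
      then have "r - 1 < 2 * n - 2" using r by auto
      then have "e \<in> T1 n \<union> T2 n"
        using True rot_e_star_in_T1[of "r - 1" n] rot_e_star_in_T2[of "r - 1" n] by blast
      then show ?thesis using T by blast
    next
      case False
      then have "e \<in> F2 n r" using F1_edge_in_F2[OF n r] by blast
      moreover have "1 \<le> r" "r \<le> 2 * n + 1" using r by auto
      ultimately show ?thesis by (rule C_I)
    qed
  qed
  have spoke: "{Num x, p} \<in> C" if xp: "x < 2 * n - 2" "p \<in> {MIInf, PIInf}" for x p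
  proof -
    from e_star_E4[OF n] obtain a where a: "a + 1 < 2 * n - 2" "e_star n = {Num a, Num (a + 1)}"
      "E4 n = {{Num a, MIInf}, {Num (a + 1), PIInf}}" "e_star n \<in> base1 n" .
    \<comment> \<open>\<open>MIInf\<close> is attached to \<open>a\<close> and \<open>PIInf\<close>
      to \<open>a + 1\<close>; neither spoke equals the deleted chord.\<close>
    have "\<exists>b\<in>{a, a + 1}. {Num b, p} \<in> base2 n"
      using xp(2) a by (auto simp: base2_def doubleton_eq_iff)
    then obtain b where b: "{Num b, p} \<in> base2 n" "b < 2 * n - 2" using a(1) by auto
    have "p \<in> {MInf, PInf, MIInf, PIInf}" using xp by blast
    then obtain k where "k < 2 * n - 2" "{Num x, p} \<in> rot n k ` base2 n"
      using spoke_in_rot[OF b(1) _ b(2) xp(1)] by metis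
    then show ?thesis using F2_base[of k n] C_I[of _ "Suc k"] by simp
  qed
  have "{MIInf, PIInf} \<in> F2 n (2 * n - 1)" by (simp add: F2_def)
  then have inf: "{MIInf, PIInf} \<in> C" using n by (elim C_I) linarith+
  fix e assume "e \<in> nsets (V2 n) 2"
  then obtain v w where e: "e = {v, w}" "v \<in> V2 n" "w \<in> V2 n" "v \<noteq> w"
    by (auto simp: nsets_2_eq)
  have mixed: "{a, b} \<in> C" if ab: "a \<in> V1 n" "b \<in> {MIInf, PIInf}" for a b
  proof (cases a)
    case (Num x)
    then show ?thesis using ab n spoke Num_in_V1 by simp
  qed (use ab T inf_in_V in auto)
  have "{v, w} \<in> C"
  proof (cases "v \<in> V1 n"; cases "w \<in> V1 n")
    assume "v \<in> V1 n" "w \<in> V1 n"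
    then show ?thesis using e V1 by (simp add: doubleton_in_nsets_2)
  next
    assume "v \<in> V1 n" "w \<notin> V1 n"
    then show ?thesis using e mixed by (simp add: V2_def)
  next
    assume "v \<notin> V1 n" "w \<in> V1 n"
    then have "{w, v} \<in> C" using e mixed by (simp add: V2_def)
    then show ?thesis by (simp add: insert_commute)
  next
    assume "v \<notin> V1 n" "w \<notin> V1 n"
    then have "{v, w} = {MIInf, PIInf}" using e by (auto simp: V2_def)
    then show ?thesis using inf by simp
  qed
  then show "e \<in> \<Union>(F2 n ` {1..2 * n + 1})" using e by (simp add: C_def)
qed

section \<open>The two one-factorisations\<close>

lemma disjoint_family_F1:
  assumes n: "n \<ge> 3"
  shows "disjoint_family_on (F1 n) {1..2 * n - 1}"
  by (rule tight_cover_disjoint_family[OF finite_V1 _ _ tight_cover_F1 F1_covers])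
    (use n card_V1 in simp_all)

lemma one_factorisation_F1:
  assumes n: "n \<ge> 3"
  shows "one_factorisation (V1 n) (nsets (V1 n) 2) (F1 n ` {1..2 * n - 1})"
  by (rule one_factorisation_tight_covers[OF finite_V1 _ _ tight_cover_F1 F1_covers])
    (use n card_V1 in simp_all)

lemma one_factorisation_F2:
  assumes n: "n \<ge> 3"
  shows "one_factorisation (V2 n) (nsets (V2 n) 2) (F2 n ` {1..2 * n + 1})"
  by (rule one_factorisation_tight_covers[OF finite_V2 _ _ tight_cover_F2 F2_covers])
    (use n card_V2 in simp_all)

section \<open>Common fixtures\<close>

lemma rot_e_star_in_F1:
  "n \<ge> 3 \<Longrightarrow> k < 2 * n - 2 \<Longrightarrow> rot n k (e_star n) \<in> F1 n (Suc k)"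
  using F1_base[of k n] e_star_in_base1[of n] by simp

lemma F1_unique:
  assumes "n \<ge> 3" "r \<in> {1..2 * n - 1}" "r' \<in> {1..2 * n - 1}" "e \<in> F1 n r" "e \<in> F1 n r'"
  shows "r = r'"
  using disjoint_family_F1[OF assms(1)] assms(2-) unfolding disjoint_family_on_def by blast

text \<open>Rotation is injective on pairs of vertices, so the claim pulls back to the base round,
  from which \<open>e_star n\<close> was deleted.\<close>

lemma rot_e_star_notin_F2:
  assumes n: "n \<ge> 3" and k: "k < 2 * n - 2"
  shows "rot n k (e_star n) \<notin> F2 n (Suc k)"
proof
  assume "rot n k (e_star n) \<in> F2 n (Suc k)"
  then obtain b where b: "b \<in> base2 n" "rot n k (e_star n) = rot n k b" using F2_base[OF k] by auto
  have "base1 n \<subseteq> nsets (V2 n) 2"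
    using tight_cover_base1[OF n] nsets_mono[of "V1 n" "V2 n" 2] by (auto simp: tight_cover_def V2_def)
  then have "e_star n \<in> nsets (V2 n) 2" using e_star_in_base1[OF n] by blast
  moreover have "b \<in> nsets (V2 n) 2" using tight_cover_base2[OF n] b by (auto simp: tight_cover_def)
  ultimately have "e_star n = b" using inj_on_rot[OF n, of k] b by (auto dest: inj_onD)
  then show False using b by (simp add: base2_def)
qed

text \<open>The range of \<open>r'\<close> exceeds the modulus by two only, so two different rounds
  can be congruent only by wrapping \<open>2 * n\<close> to 1 or \<open>2 * n + 1\<close> to
  2.\<close>

lemma round_congruence_cases:
  fixes n r r' :: nat
  assumes n: "n \<ge> 3" and r: "r \<in> {1..2 * n - 1}" "r' \<in> {1..2 * n + 1}"
    and cong: "[r' = r] (mod (2 * n - 1))"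
  shows "r' = r \<or> r = 1 \<or> r = 2"
proof (cases "r' \<le> 2 * n - 1")
  case True
  show ?thesis
  proof (cases "r' < 2 * n - 1 \<and> r < 2 * n - 1")
    case True
    then show ?thesis using cong by (simp add: cong_def)
  next
    case False
    with \<open>r' \<le> 2 * n - 1\<close> r consider "r = 2 * n - 1" | "r' = 2 * n - 1" "r < 2 * n - 1" by force
    then show ?thesis
    proof cases
      case 1
      then have "2 * n - 1 dvd r'" using cong by (simp add: cong_def mod_eq_0_iff_dvd)
      then have "2 * n - 1 \<le> r'" using r by (intro dvd_imp_le) auto
      then show ?thesis using 1 \<open>r' \<le> 2 * n - 1\<close> by simp
    next
      case 2
      then have "r = 0" using cong by (simp add: cong_def)
      then show ?thesis using r by simp
    qed
  qed
next
  case False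
  then consider "r' = 2 * n" | "r' = 2 * n + 1" using r by force
  then show ?thesis
  proof cases
    case 1
    then have "r' = 1 + (2 * n - 1)" using n by simp
    then have "[1 = r] (mod (2 * n - 1))" using cong by (simp only: cong_def mod_add_self2)
    moreover have "1 < 2 * n - 1" using n by linarith
    ultimately have "r mod (2 * n - 1) = 1" unfolding cong_def by (metis mod_less)
    then show ?thesis using r n by (cases "r = 2 * n - 1") simp_all
  next
    case 2
    then have "r' = 2 + (2 * n - 1)" using n by simp
    then have "[2 = r] (mod (2 * n - 1))" using cong by (simp only: cong_def mod_add_self2)
    then have "r mod (2 * n - 1) = 2" using n by (simp add: cong_def)
    then show ?thesis using r n by (cases "r = 2 * n - 1") simp_all
  qed
qed

text \<open>A rotation by \<open>k >= 2\<close> occurs in division one only in round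
  \<open>k + 1 >= 3\<close>, which is congruent to no other round and in division two lacks this
  edge. All other edges have a congruent partner round.\<close>

lemma common_fixtures_eq:
  assumes n: "n \<ge> 3"
  shows "{e \<in> nsets (V1 n) 2. \<exists>r\<in>{1..2 * n - 1}. \<exists>r'\<in>{1..2 * n + 1}.
      [r' = r] (mod (2 * n - 1)) \<and> e \<in> F1 n r \<inter> F2 n r'} =
    nsets (V1 n) 2 - (\<lambda>k. rot n k (e_star n)) ` {2..<2 * n - 2}" (is "?L = ?R")
proof
  show "?L \<subseteq> ?R"
  proof
    fix e assume "e \<in> ?L"
    then obtain r r' where e: "e \<in> nsets (V1 n) 2" "r \<in> {1..2 * n - 1}" "r' \<in> {1..2 * n + 1}"
      "[r' = r] (mod (2 * n - 1))" "e \<in> F1 n r" "e \<in> F2 n r'" by blast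
    have False if k: "k \<in> {2..<2 * n - 2}" "e = rot n k (e_star n)" for k
    proof -
      have k': "k < 2 * n - 2" using k by simp
      then have "r = Suc k"
        using F1_unique[OF n e(2) _ e(5), of "Suc k"] rot_e_star_in_F1[OF n k'] k by simp
      moreover from this have "r' = r" using round_congruence_cases[OF n e(2-4)] k by simp
      ultimately show False using e(6) k rot_e_star_notin_F2[OF n k'] by simp
    qed
    then show "e \<in> ?R" using e(1) by blast
  qed
  show "?R \<subseteq> ?L"
  proof
    fix e assume e: "e \<in> ?R"
    then obtain r where r: "r \<in> {1..2 * n - 1}" "e \<in> F1 n r" using F1_covers[OF n] by blast
    have "\<exists>r'\<in>{1..2 * n + 1}. [r' = r] (mod (2 * n - 1)) \<and> e \<in> F2 n r'"
    proof (cases "r < 2 * n - 1 \<and> e = rot n (r - 1) (e_star n)")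
      case True
      \<comment> \<open>Rotations by 2 or more were excluded, so only \<open>k = 0\<close> and
        \<open>k = 1\<close> remain; they lie in \<open>T1\<close> and \<open>T2\<close>, whose
        rounds are congruent to 1 and 2.\<close>
      then have "\<not> 2 \<le> r - 1" using e r by auto
      then consider "r = 1" | "r = 2" using r by force
      then show ?thesis
      proof cases
        case 1
        have "e \<in> F2 n (2 * n)" using True 1 rot_e_star_in_T1[of 0 n] n by (simp add: F2_T1)
        moreover have "2 * n = 1 + (2 * n - 1)" using n by simp
        then have "[2 * n = 1] (mod (2 * n - 1))" by (metis cong_def mod_add_self2)
        ultimately show ?thesis using 1 by (intro bexI[of _ "2 * n"]) (use n in auto)
      next
        case 2
        have "e \<in> F2 n (2 * n + 1)" using True 2 rot_e_star_in_T2[of 1 n] n unfolding F2_T2 by simp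
        moreover have "2 * n + 1 = 2 + (2 * n - 1)" using n by simp
        then have "[2 * n + 1 = 2] (mod (2 * n - 1))" by (metis cong_def mod_add_self2)
        ultimately show ?thesis using 2 by (intro bexI[of _ "2 * n + 1"]) (use n in auto)
      qed
    next
      case False
      then have "e \<in> F2 n r" using F1_edge_in_F2[OF n r] by blast
      then show ?thesis using r by (intro bexI[of _ r]) (auto simp: cong_refl)
    qed
    then show "e \<in> ?L" using e r by blast
  qed
qed

text \<open>The rotations are distinct because they lie in different rounds, and rounds of division
  one are disjoint.\<close>

lemma card_rot_e_star:
  assumes n: "n \<ge> 3"
  shows "card ((\<lambda>k. rot n k (e_star n)) ` {2..<2 * n - 2}) = 2 * n - 4"
proof -
  have "inj_on (\<lambda>k. rot n k (e_star n)) {2..<2 * n - 2}"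
  proof (rule inj_onI)
    fix i j assume ij: "i \<in> {2..<2 * n - 2}" "j \<in> {2..<2 * n - 2}"
      "rot n i (e_star n) = rot n j (e_star n)"
    then have "rot n i (e_star n) \<in> F1 n (Suc i)" "rot n i (e_star n) \<in> F1 n (Suc j)"
      using rot_e_star_in_F1[OF n, of i] rot_e_star_in_F1[OF n, of j] by simp_all
    then have "Suc i = Suc j" using ij by (intro F1_unique[OF n]) auto
    then show "i = j" by simp
  qed
  then show ?thesis by (simp add: card_image)
qed

theorem theorem4p2:
  fixes n :: nat
  assumes "n \<ge> 3"
  shows "one_factorisation (V1 n) (nsets (V1 n) 2) {F1 n r | r. 1 \<le> r \<and> r \<le> 2 * n - 1}
    \<and> one_factorisation (V2 n) (nsets (V2 n) 2) {F2 n r | r. 1 \<le> r \<and> r \<le> 2 * n + 1}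
    \<and> int (card {e \<in> nsets (V1 n) 2.
          \<exists>r\<in>{1..2 * n - 1}. \<exists>r'\<in>{1..2 * n + 1}.
            [r' = r] (mod (2 * n - 1)) \<and> e \<in> F1 n r \<inter> F2 n r'})
      = 2 * int n ^ 2 - 3 * int n + 4"
proof (intro conjI)
  have image: "{f r | r. 1 \<le> r \<and> r \<le> N} = f ` {1..N}" for f :: "nat \<Rightarrow> vertex set set" and N
    by auto
  show "one_factorisation (V1 n) (nsets (V1 n) 2) {F1 n r | r. 1 \<le> r \<and> r \<le> 2 * n - 1}"
    unfolding image by (rule one_factorisation_F1[OF assms])
  show "one_factorisation (V2 n) (nsets (V2 n) 2) {F2 n r | r. 1 \<le> r \<and> r \<le> 2 * n + 1}"
    unfolding image by (rule one_factorisation_F2[OF assms])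
  let ?X = "(\<lambda>k. rot n k (e_star n)) ` {2..<2 * n - 2}"
  have "rot n k (e_star n) \<in> nsets (V1 n) 2" for k
    using tight_cover_base1[OF assms] e_star_in_base1[OF assms]
    by (intro rot_in_nsets_V1[OF assms]) (auto simp: tight_cover_def)
  then have X: "?X \<subseteq> nsets (V1 n) 2" by blast
  have "card (nsets (V1 n) 2) = n * (2 * n - 1)"
    using assms by (simp add: card_nsets card_V1 choose_two)
  moreover have "card (nsets (V1 n) 2 - ?X) + card ?X = card (nsets (V1 n) 2)"
    using X finite_V1 by (metis card_Diff_subset card_mono finite_imp_finite_nsets finite_subset le_add_diff_inverse2)
  ultimately have "card (nsets (V1 n) 2 - ?X) + (2 * n - 4) = n * (2 * n - 1)"
    using card_rot_e_star[OF assms] by simp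
  \<comment> \<open>The additive form is cast to the integers before solving, so only
    \<open>2 * n - 4\<close> and \<open>2 * n - 1\<close> need to be exact subtractions.\<close>
  then have "int (card (nsets (V1 n) 2 - ?X)) + int (2 * n - 4) = int n * int (2 * n - 1)"
    by (metis of_nat_add of_nat_mult)
  then show "int (card {e \<in> nsets (V1 n) 2.
          \<exists>r\<in>{1..2 * n - 1}. \<exists>r'\<in>{1..2 * n + 1}.
            [r' = r] (mod (2 * n - 1)) \<and> e \<in> F1 n r \<inter> F2 n r'})
      = 2 * int n ^ 2 - 3 * int n + 4"
    unfolding common_fixtures_eq[OF assms] using assms
    by (simp add: of_nat_diff algebra_simps power2_eq_square)
qed

end
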